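(* Let $n$ and $k$ be integers with $0 \leq k < n$. Then the pairs of statistics $(\mathrm{inv},\mathrm{lmax})$ and $(\mathrm{DIS},\mathrm{cyc})$ have the same joint distribution over $A(n,k)$. Moreover, $$\sum_{\sigma \in A(n,k)} q^{\mathrm{inv}(\sigma)}t^{\mathrm{lmax}(\sigma)}=\sum_{\sigma \in A(n,k)} q^{\mathrm{DIS}(\sigma)}t^{\mathrm{cyc}(\sigma)}=(t+[k+1]_q-1)^{n-k}\prod_{i=1}^{k}(t+[i]_q-1).$$
   Context: $S_n$ is the set of permutations $\pi=\pi_1\pi_2\cdots\pi_n$ of $[n]=\{1,\ldots,n\}$, also viewed as bijections $\pi:[n]\to[n]$, $\pi(i)=\pi_i$. Products of permutations are compositions of functions, taken right to left: $(\sigma\tau)(x)=\sigma(\tau(x))$. $\mathrm{maxdrop}(\pi)=\max\{i-\pi_i : 1\le i\le n\}$ and $A(n,k)=\{\pi\in S_n : \mathrm{maxdrop}(\pi)\le k\}$. $\mathrm{inv}(\pi)$ is the number of inversions of $\pi$, i.e. of pairs $i<j$ with $\pi_i>\pi_j$. $\mathrm{lmax}(\pi)$ is the number of left-to-right maxima, i.e. of indices $i$ with $\pi_j<\pi_i$ for all $j<i$. $\mathrm{cyc}(\pi)$ is the number of cycles of $\pi$ (fixed points included). Every $\pi\in S_n$ has a unique decomposition into transpositions $\pi=(i_1,j_1)(i_2,j_2)\cdots(i_m,j_m)$ with $j_1<j_2<\cdots<j_m$ and $i_r<j_r$ for all $r$; the sorting index is $\mathrm{sor}(\pi)=\sum_{r=1}^m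 (j_r-i_r)$. The statistic $\mathrm{DIS}$ is given by $\mathrm{DIS}(\pi)=\mathrm{sor}(\pi^{-1})$. $[i]_q=1+q+\cdots+q^{i-1}$. *)

theory Defs
  imports "HOL-Combinatorics.Combinatorics"
begin

text \<open>
  A permutation of \<open>[n]\<close> is a function \<open>p :: nat \<Rightarrow> nat\<close> with \<open>p permutes {1..n}\<close>, the identity
  outside \<open>{1..n}\<close>.
\<close>

text \<open>Drops \<open>i - p i\<close> may be negative, hence the integers.\<close>

definition maxdrop :: "nat \<Rightarrow> (nat \<Rightarrow> nat) \<Rightarrow> int" where
  "maxdrop n p = Max ((\<lambda>i. int i - int (p i)) ` {1..n})"

definition maxdrop_perms :: "nat \<Rightarrow> nat \<Rightarrow> (nat \<Rightarrow> nat) set" where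
  "maxdrop_perms n k = {p. p permutes {1..n} \<and> maxdrop n p \<le> int k}"

definition inversions :: "nat \<Rightarrow> (nat \<Rightarrow> nat) \<Rightarrow> nat" where
  "inversions n p = card {(i, j). i \<in> {1..n} \<and> j \<in> {1..n} \<and> i < j \<and> p i > p j}"

definition lmax :: "nat \<Rightarrow> (nat \<Rightarrow> nat) \<Rightarrow> nat" where
  "lmax n p = card {i \<in> {1..n}. \<forall>j\<in>{1..n}. j < i \<longrightarrow> p j < p i}"

definition cyc :: "nat \<Rightarrow> (nat \<Rightarrow> nat) \<Rightarrow> nat" where
  "cyc n p = card (orbit p ` {1..n})"

text \<open>
  The list \<open>[(i\<^sub>1, j\<^sub>1), \<dots>, (i\<^sub>m, j\<^sub>m)]\<close> stands for the product
  \<open>(i\<^sub>1 j\<^sub>1) \<circ> \<dots> \<circ> (i\<^sub>m j\<^sub>m)\<close>, whose rightmost factor acts first.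
\<close>

definition sorting_decomp :: "nat \<Rightarrow> (nat \<Rightarrow> nat) \<Rightarrow> (nat \<times> nat) list \<Rightarrow> bool" where
  "sorting_decomp n p ts \<longleftrightarrow>
     (\<forall>(i, j)\<in>set ts. i \<in> {1..n} \<and> j \<in> {1..n} \<and> i < j) \<and>
     sorted_wrt (<) (map snd ts) \<and> apply_transps ts = p"

definition sor :: "nat \<Rightarrow> (nat \<Rightarrow> nat) \<Rightarrow> nat" where
  "sor n p = (\<Sum>(i, j)\<leftarrow>(THE ts. sorting_decomp n p ts). j - i)"

definition DIS :: "nat \<Rightarrow> (nat \<Rightarrow> nat) \<Rightarrow> nat" where
  "DIS n p = sor n (inv p)"

definition q_int :: "nat \<Rightarrow> 'a::comm_ring_1 \<Rightarrow> 'a" where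
  "q_int i q = (\<Sum>j<i. q ^ j)"


text \<open>The description operator in \<open>sor\<close> is well-defined on permutations.\<close>

lemma sorting_decomp_permutes:
  assumes "sorting_decomp n p ts"
  shows "p permutes {1..n}"
  using assms permutes_apply_transps[of ts "{1..n}"] unfolding sorting_decomp_def by auto

lemma sorting_decomp_Suc_iff:
  "sorting_decomp (Suc n) p ts \<longleftrightarrow>
     sorting_decomp n p ts \<or>
     (\<exists>us i. ts = us @ [(i, Suc n)] \<and> i \<in> {1..n} \<and>
             sorting_decomp n (p \<circ> Transposition.transpose i (Suc n)) us)"
proof (cases ts rule: rev_cases)
  case Nil
  then show ?thesis by (auto simp: sorting_decomp_def)
next
  case (snoc us x)
  obtain i j where x: "x = (i, j)" by force
  have comp: "f \<circ> Transposition.transpose i j = p \<longleftrightarrow> f = p \<circ> Transposition.transpose i j"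
    for f :: "nat \<Rightarrow> nat"
    by (auto simp: comp_assoc)
  show ?thesis
  proof (cases "j = Suc n")
    case True
    have bound: "(\<forall>(a, b)\<in>set us. a \<in> {1..Suc n} \<and> b \<in> {1..Suc n} \<and> a < b) \<and>
        (\<forall>y\<in>set us. snd y < Suc n) \<longleftrightarrow>
        (\<forall>(a, b)\<in>set us. a \<in> {1..n} \<and> b \<in> {1..n} \<and> a < b)"
      by fastforce
    have "\<not> sorting_decomp n p ts"
      by (simp add: snoc x True sorting_decomp_def)
    moreover have "sorting_decomp (Suc n) p ts \<longleftrightarrow>
        i \<in> {1..n} \<and> sorting_decomp n (p \<circ> Transposition.transpose i (Suc n)) us"
      unfolding sorting_decomp_def bound[symmetric]
      using comp[of "apply_transps us"] by (auto simp: snoc x True sorted_wrt_append)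
    ultimately show ?thesis by (auto simp: snoc x True)
  next
    case False
    have "sorting_decomp (Suc n) p ts \<longleftrightarrow> sorting_decomp n p ts"
    proof
      assume *: "sorting_decomp (Suc n) p ts"
      then have "j \<le> n" "\<forall>y\<in>set us. snd y < j"
        using False by (auto simp: sorting_decomp_def snoc x sorted_wrt_append)
      with * show "sorting_decomp n p ts"
        by (fastforce simp: sorting_decomp_def snoc x)
    next
      assume "sorting_decomp n p ts"
      then show "sorting_decomp (Suc n) p ts"
        by (fastforce simp: sorting_decomp_def)
    qed
    then show ?thesis using False by (auto simp: snoc x)
  qed
qed

lemma sorting_decomp_ex1:
  assumes "p permutes {1..n}"
  shows "\<exists>!ts. sorting_decomp n p ts"
  using assms
proof (induction n arbitrary: p)
  case 0
  have "ts = []" if "sorting_decomp 0 p ts" for ts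
    using that by (cases ts) (auto simp: sorting_decomp_def)
  moreover have "sorting_decomp 0 p []"
    using "0.prems" by (simp add: sorting_decomp_def)
  ultimately show ?case by blast
next
  case (Suc n)
  have fix_last: "f (Suc n) = Suc n" if "sorting_decomp n f us" for f us
    using sorting_decomp_permutes[OF that] by (auto simp: permutes_def)
  have restr: "f permutes {1..n}" if "f permutes {1..Suc n}" "f (Suc n) = Suc n" for f
    using that by (intro permutes_superset[OF that(1)]) (auto simp: le_Suc_eq)
  show ?case
  proof (cases "p (Suc n) = Suc n")
    case True
    have "\<not> sorting_decomp n (p \<circ> Transposition.transpose i (Suc n)) us" if "i \<in> {1..n}" for i us
      using fix_last[of "p \<circ> Transposition.transpose i (Suc n)" us] that True
        permutes_inj[OF Suc.prems] by (auto simp: inj_def) (metis Suc_n_not_le_n)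
    then have "sorting_decomp (Suc n) p = sorting_decomp n p"
      unfolding sorting_decomp_Suc_iff fun_eq_iff by blast
    then show ?thesis using Suc.IH[OF restr[OF Suc.prems True]] by simp
  next
    case False
    define i where "i = inv p (Suc n)"
    have pi: "p i = Suc n" using Suc.prems by (simp add: i_def permutes_inverses)
    have "i \<in> {1..Suc n}"
      unfolding i_def permutes_in_image[OF permutes_inv[OF Suc.prems]] by simp
    then have i: "i \<in> {1..n}" using pi False by (auto simp: le_Suc_eq)
    let ?f = "p \<circ> Transposition.transpose i (Suc n)"
    have "?f permutes {1..Suc n}"
      using i by (intro permutes_compose[OF permutes_swap_id Suc.prems]) auto
    then have "?f permutes {1..n}" by (rule restr) (simp add: pi)
    from Suc.IH[OF this] obtain us where us: "sorting_decomp n ?f us"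
      and uniq: "\<And>vs. sorting_decomp n ?f vs \<Longrightarrow> vs = us" by blast
    have eq: "i' = i" if "sorting_decomp n (p \<circ> Transposition.transpose i' (Suc n)) vs" for i' vs
      using fix_last[OF that] pi permutes_inj[OF Suc.prems] by (auto simp: inj_def)
    have "\<not> sorting_decomp n p vs" for vs using fix_last[of p vs] False by blast
    then have "sorting_decomp (Suc n) p ts \<longleftrightarrow> ts = us @ [(i, Suc n)]" for ts
      using us uniq i eq unfolding sorting_decomp_Suc_iff by blast
    then show ?thesis by simp
  qed
qed

end

theory Submission
  imports Defs
begin

text \<open>
  Write \<open>N = n + 1\<close>. Removing the last entry \<open>v = \<pi>\<^sub>N\<close> of \<open>\<pi> \<in> A(N,k)\<close> writes \<open>\<pi> = c\<^sub>v \<circ> p\<close> with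
  \<open>p \<in> A(n,k)\<close>, where \<open>c\<^sub>v\<close> is any permutation of \<open>{v..N}\<close> with \<open>c\<^sub>v(N) = v\<close> that does not decrease
  the other points; here \<open>v\<close> ranges freely over \<open>max(1, N - k), \<dots>, N\<close>. For the cycle
  \<open>v \<mapsto> v + 1 \<mapsto> \<dots> \<mapsto> N \<mapsto> v\<close> this adds \<open>N - v\<close> to \<open>inv\<close>, and \<open>1\<close> to \<open>lmax\<close> exactly when \<open>v = N\<close>;
  for the transposition \<open>(v N)\<close> it has the same effect on \<open>DIS\<close> and \<open>cyc\<close>. So both pairs satisfy
  the same recursion, whose \<open>N\<close>-th step contributes the factor \<open>t + [min(N, k + 1)]\<^sub>q - 1\<close>.
\<close>

subsection \<open>Removing the last entry\<close>

text \<open>Unlike \<open>maxdrop_perms\<close>, this also makes sense for \<open>n = 0\<close>, where \<open>maxdrop\<close> is a maximum over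
  the empty set.\<close>

definition drop_perms :: "nat \<Rightarrow> nat \<Rightarrow> (nat \<Rightarrow> nat) set" where
  "drop_perms n k = {p. p permutes {1..n} \<and> (\<forall>i\<in>{1..n}. i \<le> p i + k)}"

lemma maxdrop_perms_eq_drop_perms:
  assumes "0 < n"
  shows "maxdrop_perms n k = drop_perms n k"
proof -
  have "maxdrop n p \<le> int k \<longleftrightarrow> (\<forall>i\<in>{1..n}. i \<le> p i + k)" for p
    unfolding maxdrop_def using assms by (subst Max_le_iff) force+
  then show ?thesis by (simp add: maxdrop_perms_def drop_perms_def)
qed

lemma finite_drop_perms: "finite (drop_perms n k)"
  by (rule finite_subset[OF _ finite_permutations[of "{1..n}"]]) (auto simp: drop_perms_def)

lemma drop_perms_0: "drop_perms 0 k = {id}"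
  by (auto simp: drop_perms_def)

definition last_entries :: "nat \<Rightarrow> nat \<Rightarrow> nat set" where
  "last_entries n k = {v \<in> {1..n}. n \<le> v + k}"

text \<open>The properties shared by the cycles and the transpositions, so that one bijection serves
  both pairs of statistics. Not decreasing the points up to \<open>n\<close> keeps drops from
  growing; the support in \<open>{v..Suc n}\<close> gives the converse.\<close>

definition last_entry_family :: "nat \<Rightarrow> (nat \<Rightarrow> nat \<Rightarrow> nat) \<Rightarrow> bool" where
  "last_entry_family n c \<longleftrightarrow> (\<forall>v\<in>{1..Suc n}. c v permutes {v..Suc n} \<and> c v (Suc n) = v \<and>
     (\<forall>x\<le>n. x \<le> c v x))"

text \<open>The map from \<open>(v, p)\<close> to \<open>c v \<circ> p\<close> is a bijection: its
  inverse reads off \<open>v\<close> as the value at \<open>Suc n\<close> and cancels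
  \<open>c v\<close>.\<close>

lemma sum_drop_perms_Suc:
  fixes G :: "(nat \<Rightarrow> nat) \<Rightarrow> 'b::comm_monoid_add"
  assumes c: "last_entry_family n c"
  shows "(\<Sum>p\<in>drop_perms (Suc n) k. G p) =
    (\<Sum>v\<in>last_entries (Suc n) k. \<Sum>p\<in>drop_perms n k. G (c v \<circ> p))"
proof -
  have cp: "c v permutes {v..Suc n}" and cN: "c v (Suc n) = v"
    and cx: "x \<le> n \<Longrightarrow> x \<le> c v x" if "v \<in> {1..Suc n}" for v x
    using c that by (auto simp: last_entry_family_def)
  have cperm: "c v permutes {1..Suc n}" if "v \<in> {1..Suc n}" for v
    using that by (intro permutes_subset[OF cp]) auto
  have fixN: "p (Suc n) = Suc n" if "p permutes {1..n}" for p
    using that by (simp add: permutes_def)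
  have fwd: "c v \<circ> p \<in> drop_perms (Suc n) k"
    if v: "v \<in> last_entries (Suc n) k" and p: "p \<in> drop_perms n k" for v p
  proof -
    have v': "v \<in> {1..Suc n}" "Suc n \<le> v + k" using v by (auto simp: last_entries_def)
    have p': "p permutes {1..n}" and pk: "\<And>i. i \<in> {1..n} \<Longrightarrow> i \<le> p i + k"
      using p by (auto simp: drop_perms_def)
    have "c v \<circ> p permutes {1..Suc n}"
      by (intro permutes_compose[OF _ cperm[OF v'(1)]] permutes_subset[OF p']) auto
    moreover have "i \<le> c v (p i) + k" if "i \<in> {1..Suc n}" for i
    proof (cases "i = Suc n")
      case True
      then show ?thesis using v' fixN[OF p'] cN by simp
    next
      case False
      then have i: "i \<in> {1..n}" using that by auto
      then have "p i \<in> {1..n}" using permutes_in_image[OF p'] by blast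
      then have "p i \<le> c v (p i)" using cx[OF v'(1)] by simp
      then show ?thesis using pk[OF i] by simp
    qed
    ultimately show ?thesis by (simp add: drop_perms_def)
  qed
  have bwd: "inv (c (r (Suc n))) \<circ> r \<in> drop_perms n k" "r (Suc n) \<in> last_entries (Suc n) k"
    if r: "r \<in> drop_perms (Suc n) k" for r
  proof -
    define v where "v = r (Suc n)"
    have r': "r permutes {1..Suc n}" and rk: "\<And>i. i \<in> {1..Suc n} \<Longrightarrow> i \<le> r i + k"
      using r by (auto simp: drop_perms_def)
    have v: "v \<in> {1..Suc n}" unfolding v_def permutes_in_image[OF r'] by simp
    have vk: "Suc n \<le> v + k" using rk[of "Suc n"] by (simp add: v_def)
    show "r (Suc n) \<in> last_entries (Suc n) k" using v vk by (auto simp: last_entries_def v_def)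
    let ?p = "inv (c v) \<circ> r"
    have P: "?p permutes {1..Suc n}"
      by (rule permutes_compose[OF r' permutes_inv[OF cperm[OF v]]])
    have PN: "?p (Suc n) = Suc n"
      using cN[OF v] permutes_inverses(2)[OF cperm[OF v], of "Suc n"] by (simp flip: v_def)
    have p: "?p permutes {1..n}"
      using PN by (intro permutes_superset[OF P]) (auto simp: le_Suc_eq)
    \<comment> \<open>Values below \<open>v\<close> are fixed by \<open>c v\<close>, so the bound
      for \<open>r\<close> carries over; a value of at least \<open>v\<close> satisfies it because
      \<open>Suc n \<le> v + k\<close> and \<open>i \<le> n\<close>.\<close>
    have "i \<le> ?p i + k" if i: "i \<in> {1..n}" for i
    proof (cases "?p i < v")
      case True
      then have "c v (?p i) = ?p i" using cp[OF v] by (simp add: permutes_def)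
      moreover have "c v (?p i) = r i" using permutes_inverses(1)[OF cperm[OF v]] by simp
      ultimately show ?thesis using rk[of i] i by simp
    next
      case False
      then show ?thesis using vk i by simp
    qed
    then show "inv (c (r (Suc n))) \<circ> r \<in> drop_perms n k"
      using p by (simp add: drop_perms_def v_def)
  qed
  have entry: "(c v \<circ> p) (Suc n) = v"
    if "v \<in> last_entries (Suc n) k" "p \<in> drop_perms n k" for v p
    using that fixN[of p] cN[of v] by (auto simp: last_entries_def drop_perms_def)
  have "(\<Sum>p\<in>drop_perms (Suc n) k. G p) =
    (\<Sum>(v, p)\<in>last_entries (Suc n) k \<times> drop_perms n k. G (c v \<circ> p))"
  proof (rule sum.reindex_bij_witness
      [where j = "\<lambda>r. (r (Suc n), inv (c (r (Suc n))) \<circ> r)" and i = "\<lambda>(v, p). c v \<circ> p"])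
    fix r assume r: "r \<in> drop_perms (Suc n) k"
    have "r (Suc n) \<in> {1..Suc n}" using bwd(2)[OF r] by (auto simp: last_entries_def)
    then have "c (r (Suc n)) \<circ> (inv (c (r (Suc n))) \<circ> r) = r"
      using permutes_inv_o(1)[OF cperm] by (simp flip: comp_assoc)
    then show "(case (r (Suc n), inv (c (r (Suc n))) \<circ> r) of (v, p) \<Rightarrow> c v \<circ> p) = r"
      and "(case (r (Suc n), inv (c (r (Suc n))) \<circ> r) of (v, p) \<Rightarrow> G (c v \<circ> p)) = G r" by simp_all
    show "(r (Suc n), inv (c (r (Suc n))) \<circ> r) \<in> last_entries (Suc n) k \<times> drop_perms n k"
      using bwd[OF r] by simp
  next
    fix vp assume "vp \<in> last_entries (Suc n) k \<times> drop_perms n k"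
    then obtain v p where vp: "vp = (v, p)" "v \<in> last_entries (Suc n) k" "p \<in> drop_perms n k"
      by auto
    have v: "v \<in> {1..Suc n}" using vp(2) by (simp add: last_entries_def)
    show "(case vp of (v, p) \<Rightarrow> c v \<circ> p) \<in> drop_perms (Suc n) k"
      using fwd[OF vp(2,3)] by (simp add: vp(1))
    have "inv (c v) \<circ> (c v \<circ> p) = p"
      using permutes_inv_o(2)[OF cperm[OF v]] by (simp flip: comp_assoc)
    then show "((case vp of (v, p) \<Rightarrow> c v \<circ> p) (Suc n),
        inv (c ((case vp of (v, p) \<Rightarrow> c v \<circ> p) (Suc n))) \<circ> (case vp of (v, p) \<Rightarrow> c v \<circ> p)) = vp"
      using entry[OF vp(2,3)] by (simp add: vp(1))
  qed
  then show ?thesis by (simp add: sum.cartesian_product)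
qed


subsection \<open>Inversions and left-to-right maxima\<close>

text \<open>In one-line notation, \<open>shift_cycle n v \<circ> p\<close> appends \<open>v\<close>
  to the word of \<open>p\<close> after raising the entries from \<open>v\<close> on by one.\<close>

definition shift_cycle :: "nat \<Rightarrow> nat \<Rightarrow> nat \<Rightarrow> nat" where
  "shift_cycle n v x = (if x = Suc n then v else if v \<le> x \<and> x \<le> n then Suc x else x)"

lemma last_entry_family_shift_cycle: "last_entry_family n (shift_cycle n)"
proof -
  have "shift_cycle n v permutes {v..Suc n}" if "v \<in> {1..Suc n}" for v
  proof (rule bij_imp_permutes)
    show "bij_betw (shift_cycle n v) {v..Suc n} {v..Suc n}"
      by (rule bij_betw_byWitness[where f' = "\<lambda>y. if y = v then Suc n else y - 1"])
        (use that in \<open>auto simp: shift_cycle_def\<close>)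
  qed (use that in \<open>auto simp: shift_cycle_def\<close>)
  then show ?thesis by (auto simp: last_entry_family_def shift_cycle_def)
qed

text \<open>Comparisons among the first \<open>n\<close> entries survive the composition, so only
  the last position can change \<open>inversions\<close> and \<open>lmax\<close>.\<close>

lemma shift_cycle_less_iff:
  "x \<le> n \<Longrightarrow> y \<le> n \<Longrightarrow> shift_cycle n v x < shift_cycle n v y \<longleftrightarrow> x < y"
  by (auto simp: shift_cycle_def)

text \<open>The new inversions are the pairs \<open>(i, Suc n)\<close> with
  \<open>v \<le> p i\<close>; as \<open>p\<close> is a bijection, there is one for each value in
  \<open>{v..n}\<close>.\<close>

lemma inversions_shift_cycle:
  assumes p: "p permutes {1..n}" and v: "v \<in> {1..Suc n}"
  shows "inversions (Suc n) (shift_cycle n v \<circ> p) = inversions n p + (Suc n - v)"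
proof -
  have pN: "p (Suc n) = Suc n" using p by (simp add: permutes_def)
  have pi: "p i \<le> n" if "i \<in> {1..n}" for i using permutes_in_image[OF p, of i] that by simp
  let ?A = "{(i, j). i \<in> {1..n} \<and> j \<in> {1..n} \<and> i < j \<and> p i > p j}"
  let ?B = "{i \<in> {1..n}. v \<le> p i}"
  \<comment> \<open>The entry equal to \<open>v\<close> counts as well: it is raised to
    \<open>Suc v\<close>, above the new last entry.\<close>
  have big: "shift_cycle n v (p i) > v \<longleftrightarrow> v \<le> p i" if "i \<in> {1..n}" for i
    using pi[OF that] by (auto simp: shift_cycle_def)
  have "{(i, j). i \<in> {1..Suc n} \<and> j \<in> {1..Suc n} \<and> i < j \<and>
      (shift_cycle n v \<circ> p) i > (shift_cycle n v \<circ> p) j} = ?A \<union> (\<lambda>i. (i, Suc n)) ` ?B" (is "?L = ?R")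
  proof (intro set_eqI, clarify)
    fix i j
    show "(i, j) \<in> ?L \<longleftrightarrow> (i, j) \<in> ?R"
    proof (cases "j = Suc n")
      case True
      \<comment> \<open>Unfolding only at \<open>Suc n\<close> leaves intact the term that
        \<open>big\<close> speaks of.\<close>
      then show ?thesis using big[of i] pN by (auto simp: shift_cycle_def[of n v "Suc n"])
    next
      case False
      then show ?thesis using pi[of i] pi[of j] shift_cycle_less_iff[of "p j" n "p i" v] by auto
    qed
  qed
  moreover have "card (?A \<union> (\<lambda>i. (i, Suc n)) ` ?B) = card ?A + card ((\<lambda>i. (i, Suc n)) ` ?B)"
    by (rule card_Un_disjoint) (auto intro: finite_subset[of _ "{1..n} \<times> {1..n}"])
  moreover have "card ((\<lambda>i. (i, Suc n)) ` ?B) = card ?B"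
    by (rule card_image) (simp add: inj_on_def)
  moreover have "card ?B = card (p ` ?B)"
    by (rule card_image[symmetric]) (rule permutes_inj_on[OF p])
  moreover have "p ` ?B = {v..n}"
  proof (intro set_eqI iffI)
    fix y assume "y \<in> {v..n}"
    then have "y \<in> p ` {1..n}" using v unfolding permutes_image[OF p] by simp
    then show "y \<in> p ` ?B" using \<open>y \<in> {v..n}\<close> by auto
  qed (use pi in auto)
  ultimately show ?thesis by (simp add: inversions_def)
qed

lemma lmax_shift_cycle:
  assumes p: "p permutes {1..n}" and v: "v \<in> {1..Suc n}"
  shows "lmax (Suc n) (shift_cycle n v \<circ> p) = lmax n p + of_bool (v = Suc n)"
proof -
  have pN: "p (Suc n) = Suc n" using p by (simp add: permutes_def)
  have pi: "p i \<le> n" if "i \<in> {1..n}" for i using permutes_in_image[OF p, of i] that by simp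
  let ?r = "shift_cycle n v \<circ> p"
  have less: "?r j < ?r i \<longleftrightarrow> p j < p i" if "i \<in> {1..n}" "j \<in> {1..n}" for i j
    using shift_cycle_less_iff pi that by simp
  have rN: "?r (Suc n) = v" by (simp add: pN shift_cycle_def)
  have last: "(\<forall>j\<in>{1..n}. ?r j < v) \<longleftrightarrow> v = Suc n"
  proof
    assume *: "\<forall>j\<in>{1..n}. ?r j < v"
    show "v = Suc n"
    proof (rule ccontr)
      assume "v \<noteq> Suc n"
      \<comment> \<open>For \<open>v \<le> n\<close>, the entry \<open>v\<close> of \<open>p\<close>
        becomes \<open>Suc v\<close> and exceeds the last entry.\<close>
      then have "v \<in> p ` {1..n}" using v unfolding permutes_image[OF p] by auto
      then obtain j where "j \<in> {1..n}" "p j = v" by auto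
      then show False using * by (force simp: shift_cycle_def split: if_splits)
    qed
  next
    assume "v = Suc n"
    then show "\<forall>j\<in>{1..n}. ?r j < v" using pi by (force simp: shift_cycle_def)
  qed
  let ?A = "{i \<in> {1..n}. \<forall>j\<in>{1..n}. j < i \<longrightarrow> p j < p i}"
  have "{i \<in> {1..Suc n}. \<forall>j\<in>{1..Suc n}. j < i \<longrightarrow> ?r j < ?r i} =
      ?A \<union> (if v = Suc n then {Suc n} else {})" (is "?L = ?R")
  proof (rule set_eqI)
    fix i
    consider "i = Suc n" | "i \<in> {1..n}" | "i \<notin> {1..Suc n}" by fastforce
    then show "i \<in> ?L \<longleftrightarrow> i \<in> ?R"
    proof cases
      case 1
      have "i \<in> ?L \<longleftrightarrow> (\<forall>j\<in>{1..n}. ?r j < v)"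
        unfolding 1 using rN by (auto simp: less_Suc_eq_le)
      then show ?thesis using last 1 by auto
    next
      case 2
      then have "i \<in> ?L \<longleftrightarrow> (\<forall>j\<in>{1..n}. j < i \<longrightarrow> ?r j < ?r i)" by auto
      then show ?thesis using less 2 by auto
    qed auto
  qed
  then show ?thesis by (simp add: lmax_def)
qed


subsection \<open>Sorting index and cycles\<close>

lemma last_entry_family_transpose:
  "last_entry_family n (\<lambda>v. Transposition.transpose v (Suc n))"
  by (auto simp: last_entry_family_def transpose_def intro: permutes_swap_id)

lemma sor_eqI:
  assumes "sorting_decomp n p ts"
  shows "sor n p = (\<Sum>(i, j)\<leftarrow>ts. j - i)"
  using the1_equality[OF sorting_decomp_ex1[OF sorting_decomp_permutes[OF assms]] assms]
  by (simp add: sor_def)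

text \<open>Inversion turns the left factor into a right one. Unless \<open>v = Suc n\<close>, this
  appends \<open>(v, Suc n)\<close> to the decomposition of \<open>inv p\<close>, at cost
  \<open>Suc n - v\<close>.\<close>

lemma DIS_transpose:
  assumes p: "p permutes {1..n}" and v: "v \<in> {1..Suc n}"
  shows "DIS (Suc n) (Transposition.transpose v (Suc n) \<circ> p) = DIS n p + (Suc n - v)"
proof -
  obtain ts where ts: "sorting_decomp n (inv p) ts"
    using sorting_decomp_ex1[OF permutes_inv[OF p]] by blast
  have inv: "inv (Transposition.transpose v (Suc n) \<circ> p) = inv p \<circ> Transposition.transpose v (Suc n)"
    using o_inv_distrib[OF bij_transpose permutes_bij[OF p]] by simp
  show ?thesis
  proof (cases "v = Suc n")
    case True
    have "sorting_decomp (Suc n) (inv p) ts" using ts by (simp add: sorting_decomp_Suc_iff)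
    then show ?thesis using sor_eqI[OF ts] sor_eqI[of "Suc n" "inv p" ts] True
      by (simp add: DIS_def)
  next
    case False
    have "inv p \<circ> Transposition.transpose v (Suc n) \<circ> Transposition.transpose v (Suc n) = inv p"
      by (simp add: comp_assoc)
    then have "sorting_decomp (Suc n) (inv p \<circ> Transposition.transpose v (Suc n)) (ts @ [(v, Suc n)])"
      using ts v False unfolding sorting_decomp_Suc_iff by auto
    from sor_eqI[OF this] show ?thesis using sor_eqI[OF ts] by (simp add: DIS_def inv)
  qed
qed

text \<open>A point that \<open>p\<close> sends to \<open>v\<close> now goes to \<open>a\<close>,
  and \<open>a\<close> goes to \<open>v\<close>; all other points move as before. So
  \<open>a\<close> is inserted just before \<open>v\<close>.\<close>

lemma orbit_transpose_comp:
  assumes fix_a: "p a = a" and inj: "inj p" and x: "x \<noteq> a" and v: "v \<noteq> a"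
  shows "orbit (Transposition.transpose v a \<circ> p) x =
    orbit p x \<union> (if v \<in> orbit p x then {a} else {})"
    (is "orbit ?r x = _")
proof -
  have pa: "p y = a \<longleftrightarrow> y = a" for y using fix_a inj by (metis injD)
  have r: "?r y = (if y = a then v else if p y = v then a else p y)" for y
    using fix_a pa[of y] by (auto simp: transpose_def)
  have fwd: "y \<in> orbit p x \<and> y \<noteq> a \<or> y = a \<and> v \<in> orbit p x" if "y \<in> orbit ?r x" for y
    using that
  proof induction
    case base
    show ?case using x pa[of x] orbit.base[of p x] by (auto simp: r simp del: comp_apply)
  next
    case (step y)
    then show ?case using v pa[of y] orbit.step[of y p x] by (auto simp: r simp del: comp_apply)
  qed
  \<comment> \<open>A step of \<open>p\<close> from a point other than \<open>a\<close> becomes one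
    step of \<open>?r\<close>, or two, through \<open>a\<close>, when it leads to
    \<open>v\<close>.\<close>
  have r_step: "p y \<in> orbit ?r x" "p y = v \<Longrightarrow> a \<in> orbit ?r x"
    if y: "y = x \<or> y \<in> orbit ?r x" "y \<noteq> a" for y
  proof -
    have ry: "?r y \<in> orbit ?r x" using y by (blast intro: orbit.intros)
    show a: "a \<in> orbit ?r x" if "p y = v"
      using ry y(2) that by (simp add: r del: comp_apply)
    show "p y \<in> orbit ?r x"
    proof (cases "p y = v")
      case True
      show ?thesis using orbit.step[OF a[OF True]] True by (simp add: r del: comp_apply)
    next
      case False
      then show ?thesis using ry y(2) by (simp add: r del: comp_apply)
    qed
  qed
  \<comment> \<open>The induction also records \<open>y \<noteq> a\<close>, which
    \<open>r_step\<close> needs, and that reaching \<open>v\<close> entails reaching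
    \<open>a\<close>, which accounts for the extra point.\<close>
  have bwd: "y \<in> orbit ?r x \<and> y \<noteq> a \<and> (y = v \<longrightarrow> a \<in> orbit ?r x)" if "y \<in> orbit p x" for y
    using that
  proof induction
    case base
    show ?case using r_step[of x] x pa[of x] by blast
  next
    case (step y)
    then show ?case using r_step[of y] pa[of y] by blast
  qed
  show ?thesis using fwd bwd by auto
qed

text \<open>For \<open>v = Suc n\<close> a fixed point is added; otherwise \<open>Suc n\<close>
  joins the orbit of \<open>v\<close> and the number of orbits stays the same.\<close>

lemma cyc_transpose:
  assumes p: "p permutes {1..n}" and v: "v \<in> {1..Suc n}"
  shows "cyc (Suc n) (Transposition.transpose v (Suc n) \<circ> p) = cyc n p + of_bool (v = Suc n)"
proof -
  have pN: "p (Suc n) = Suc n" using p by (simp add: permutes_def)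
  have orb: "orbit p i \<subseteq> {1..n}" if "i \<in> {1..n}" for i
    using permutes_orbit_subset[OF p that] .
  have ivl: "{1..Suc n} = insert (Suc n) {1..n}" by auto
  show ?thesis
  proof (cases "v = Suc n")
    case True
    have "Suc n \<in> orbit p (Suc n)" using orbit.base[of p "Suc n"] pN by simp
    then have "orbit p (Suc n) \<notin> orbit p ` {1..n}" using orb by fastforce
    then show ?thesis unfolding cyc_def ivl by (simp add: True)
  next
    case False
    let ?r = "Transposition.transpose v (Suc n) \<circ> p"
    let ?f = "\<lambda>A. A \<union> (if v \<in> A then {Suc n} else {})"
    have vn: "v \<in> {1..n}" using v False by auto
    have r: "?r permutes {1..Suc n}"
      using v by (intro permutes_compose[OF _ permutes_swap_id] permutes_subset[OF p]) auto
    have rN: "?r (Suc n) = v" by (simp add: pN)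
    have "orbit ?r i = ?f (orbit p i)" if "i \<in> {1..n}" for i
      using that False by (intro orbit_transpose_comp pN permutes_inj[OF p]) auto
    then have "orbit ?r ` {1..n} = ?f ` orbit p ` {1..n}" by (auto simp: image_iff)
    \<comment> \<open>Intersecting with \<open>{1..n}\<close> recovers the old orbit, so distinct
      orbits stay distinct.\<close>
    moreover have "inj_on ?f (orbit p ` {1..n})"
    proof (rule inj_onI)
      fix A B assume "A \<in> orbit p ` {1..n}" "B \<in> orbit p ` {1..n}" and eq: "?f A = ?f B"
      then have "A \<subseteq> {1..n}" "B \<subseteq> {1..n}" using orb by blast+
      then have "?f A \<inter> {1..n} = A" "?f B \<inter> {1..n} = B" by auto
      then show "A = B" using eq by metis
    qed
    \<comment> \<open>Since \<open>?r\<close> sends \<open>Suc n\<close> to \<open>v\<close>, the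
      new point has no orbit of its own.\<close>
    moreover have "orbit ?r (Suc n) \<in> orbit ?r ` {1..n}"
    proof -
      have "permutation ?r" using r permutation_permutes by blast
      from permutation_orbit_step[OF this, of "Suc n"] have "orbit ?r (Suc n) = orbit ?r v"
        unfolding rN by simp
      then show ?thesis using vn by blast
    qed
    ultimately show ?thesis
      unfolding cyc_def ivl by (simp add: insert_absorb card_image False)
  qed
qed


subsection \<open>The joint distribution\<close>

lemma sum_drop_perms_inversions_lmax_Suc:
  "(\<Sum>p\<in>drop_perms (Suc n) k. F (inversions (Suc n) p) (lmax (Suc n) p)) =
   (\<Sum>v\<in>last_entries (Suc n) k. \<Sum>p\<in>drop_perms n k.
      F (inversions n p + (Suc n - v)) (lmax n p + of_bool (v = Suc n)))"
  unfolding sum_drop_perms_Suc[OF last_entry_family_shift_cycle]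
  by (intro sum.cong refl)
    (simp add: inversions_shift_cycle lmax_shift_cycle drop_perms_def last_entries_def)

lemma sum_drop_perms_DIS_cyc_Suc:
  "(\<Sum>p\<in>drop_perms (Suc n) k. F (DIS (Suc n) p) (cyc (Suc n) p)) =
   (\<Sum>v\<in>last_entries (Suc n) k. \<Sum>p\<in>drop_perms n k.
      F (DIS n p + (Suc n - v)) (cyc n p + of_bool (v = Suc n)))"
  unfolding sum_drop_perms_Suc[OF last_entry_family_transpose]
  by (intro sum.cong refl)
    (simp add: DIS_transpose cyc_transpose drop_perms_def last_entries_def)

lemma DIS_0: "DIS 0 (\<lambda>x. x) = 0"
  using sor_eqI[of 0 id "[]"] by (simp add: DIS_def sorting_decomp_def flip: id_def)

text \<open>\<open>F\<close> is arbitrary because the recursion shifts its arguments by amounts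
  depending on \<open>v\<close>. Indicators as \<open>F\<close> yield the joint distribution,
  monomials the generating functions.\<close>

lemma sum_drop_perms_equidistributed:
  fixes F :: "nat \<Rightarrow> nat \<Rightarrow> 'b::comm_monoid_add"
  shows "(\<Sum>p\<in>drop_perms n k. F (inversions n p) (lmax n p)) =
    (\<Sum>p\<in>drop_perms n k. F (DIS n p) (cyc n p))"
proof (induction n arbitrary: F)
  case 0
  show ?case by (simp add: drop_perms_0 inversions_def lmax_def DIS_0 cyc_def)
next
  case (Suc n)
  show ?case
    unfolding sum_drop_perms_inversions_lmax_Suc[of F] sum_drop_perms_DIS_cyc_Suc[of F]
    by (intro sum.cong refl Suc.IH)
qed

text \<open>With \<open>j = Suc n - v\<close>, the exponent runs from 0 to \<open>min n k\<close>;
  the term \<open>j = 0\<close> is \<open>t\<close> instead of 1, hence the correction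
  \<open>t - 1\<close> to the q-integer.\<close>

lemma sum_last_entries:
  fixes q t :: "'a::comm_ring_1"
  shows "(\<Sum>v\<in>last_entries (Suc n) k. q ^ (Suc n - v) * t ^ of_bool (v = Suc n)) =
    t + q_int (min (Suc n) (k + 1)) q - 1"
proof -
  have "(\<Sum>v\<in>last_entries (Suc n) k. q ^ (Suc n - v) * t ^ of_bool (v = Suc n)) =
      (\<Sum>j<Suc (min n k). q ^ j * t ^ of_bool (j = 0))"
    by (rule sum.reindex_bij_witness[where i = "\<lambda>j. Suc n - j" and j = "\<lambda>v. Suc n - v"])
      (auto simp: last_entries_def)
  also have "\<dots> = t + (\<Sum>j<min n k. q ^ Suc j)"
    by (subst sum.lessThan_Suc_shift) simp
  also have "\<dots> = t + q_int (Suc (min n k)) q - 1"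
    unfolding q_int_def by (subst sum.lessThan_Suc_shift) simp
  finally show ?thesis by simp
qed

text \<open>The contribution of \<open>v\<close> does not depend on \<open>p\<close>, so the double
  sum of the recursion splits off one factor per step.\<close>

lemma sum_drop_perms_DIS_cyc:
  fixes q t :: "'a::comm_ring_1"
  shows "(\<Sum>p\<in>drop_perms n k. q ^ DIS n p * t ^ cyc n p) =
    (\<Prod>i=1..n. t + q_int (min i (k + 1)) q - 1)"
proof (induction n)
  case 0
  show ?case by (simp add: drop_perms_0 DIS_0 cyc_def)
next
  case (Suc n)
  have "(\<Sum>p\<in>drop_perms (Suc n) k. q ^ DIS (Suc n) p * t ^ cyc (Suc n) p) =
      (\<Sum>v\<in>last_entries (Suc n) k. q ^ (Suc n - v) * t ^ of_bool (v = Suc n)) *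
      (\<Sum>p\<in>drop_perms n k. q ^ DIS n p * t ^ cyc n p)"
    unfolding sum_drop_perms_DIS_cyc_Suc[of "\<lambda>a b. q ^ a * t ^ b"] sum_product
    by (intro sum.cong refl) (simp add: power_add mult_ac)
  then show ?case unfolding Suc.IH sum_last_entries by (simp add: mult.commute)
qed

theorem theorem1p1:
  fixes n k :: nat and q t :: "'a::comm_ring_1"
  assumes "k < n"
  shows "(\<forall>a b. card {p \<in> maxdrop_perms n k. inversions n p = a \<and> lmax n p = b} =
                card {p \<in> maxdrop_perms n k. DIS n p = a \<and> cyc n p = b}) \<and>
         (\<Sum>p\<in>maxdrop_perms n k. q ^ inversions n p * t ^ lmax n p) =
           (\<Sum>p\<in>maxdrop_perms n k. q ^ DIS n p * t ^ cyc n p) \<and>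
         (\<Sum>p\<in>maxdrop_perms n k. q ^ DIS n p * t ^ cyc n p) =
           (t + q_int (k + 1) q - 1) ^ (n - k) * (\<Prod>i=1..k. t + q_int i q - 1)"
proof -
  have A: "maxdrop_perms n k = drop_perms n k"
    using assms by (simp add: maxdrop_perms_eq_drop_perms)
  have card: "card {p \<in> drop_perms n k. P p} = (\<Sum>p\<in>drop_perms n k. of_bool (P p))" for P
    by (simp add: finite_drop_perms Int_def)
  have "card {p \<in> drop_perms n k. inversions n p = a \<and> lmax n p = b} =
      card {p \<in> drop_perms n k. DIS n p = a \<and> cyc n p = b}" for a b
    unfolding card using sum_drop_perms_equidistributed[of "\<lambda>x y. of_bool (x = a \<and> y = b)"] .
  moreover have "(\<Sum>p\<in>drop_perms n k. q ^ inversions n p * t ^ lmax n p) =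
      (\<Sum>p\<in>drop_perms n k. q ^ DIS n p * t ^ cyc n p)"
    by (rule sum_drop_perms_equidistributed)
  moreover have "(\<Prod>i=1..n. t + q_int (min i (k + 1)) q - 1) =
      (t + q_int (k + 1) q - 1) ^ (n - k) * (\<Prod>i=1..k. t + q_int i q - 1)"
  proof -
    \<comment> \<open>Up to \<open>k\<close> the minimum is \<open>i\<close>; from
      \<open>k + 1\<close> on it is constantly \<open>k + 1\<close>, giving \<open>n - k\<close>
      equal factors.\<close>
    have "{1..n} = {1..k} \<union> {k<..n}" using assms by auto
    then have "(\<Prod>i=1..n. t + q_int (min i (k + 1)) q - 1) =
        (\<Prod>i=1..k. t + q_int (min i (k + 1)) q - 1) * (\<Prod>i\<in>{k<..n}. t + q_int (min i (k + 1)) q - 1)"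
      by (simp add: prod.union_disjoint ivl_disj_int)
    also have "(\<Prod>i=1..k. t + q_int (min i (k + 1)) q - 1) = (\<Prod>i=1..k. t + q_int i q - 1)"
      by (intro prod.cong) (auto simp: min_absorb1)
    also have "(\<Prod>i\<in>{k<..n}. t + q_int (min i (k + 1)) q - 1) = (\<Prod>i\<in>{k<..n}. t + q_int (k + 1) q - 1)"
      by (intro prod.cong) (auto simp: min_absorb2)
    finally show ?thesis by (simp add: mult.commute)
  qed
  ultimately show ?thesis by (simp add: A sum_drop_perms_DIS_cyc)
qed

end
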